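(* Let $G$ be a graph on $n$ vertices that either belongs to a homogeneous coherent configuration or is $1$-walk regular. Let $S$ be a clique and $T$ a coclique in $G$. Then $$|S|\,|T| \leq n.$$
   Context: Graphs are finite, simple and undirected. A coclique is an independent (stable) set of vertices. $I$ is the identity matrix, $J$ is the all-ones matrix, and $\circ$ is the Schur (entrywise) product. A coherent configuration is a finite set of $01$ matrices $\{A_0,\dotsc,A_d\}$ (all $n\times n$) such that: (i) $\sum_{i=0}^d A_i = J$; (ii) for each $i$, if some diagonal entry of $A_i$ is non-zero, then $A_i$ is diagonal; (iii) the set is closed under transposition; (iv) for all $i,j$, $A_iA_j$ is a linear combination of the matrices in the configuration. It is homogeneous if the identity matrix is one of its matrices. A graph belongs to a coherent configuration if its adjacency matrix is a sum of (distinct) matrices of the configuration. A graph with adjacency matrix $A$ is $1$-walk regular if for every positive integer $k$ there are constants $a_k$ and $b_k$ such that $A^k\circ I = a_k I$ and $A^k\circ A = b_k A$. *)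

theory Defs
  imports "HOL-Analysis.Analysis" "HOL-Library.Ramsey"
begin

text \<open>
  A finite simple graph has all of a finite type as its vertices, and a set of two-element
  sets of vertices as its edges. Cliques and cocliques are the constants clique and indep
  of HOL-Library.Ramsey.
\<close>

definition simple_graph :: "'v::finite set set \<Rightarrow> bool" where
  "simple_graph E \<longleftrightarrow> E \<subseteq> [UNIV]\<^bsup>2\<^esup>"

definition adjacency_matrix :: "'v::finite set set \<Rightarrow> real^'v^'v" where
  "adjacency_matrix E = (\<chi> u v. if {u, v} \<in> E then 1 else 0)"

definition diagonal_matrix :: "real^'v::finite^'v \<Rightarrow> bool" where
  "diagonal_matrix A \<longleftrightarrow> (\<forall>u v. u \<noteq> v \<longrightarrow> A $ u $ v = 0)"

definition coherent_configuration :: "(real^'v::finite^'v) set \<Rightarrow> bool" where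
  "coherent_configuration C \<longleftrightarrow>
     finite C \<and>
     (\<forall>A\<in>C. \<forall>u v. A $ u $ v \<in> {0, 1}) \<and>
     \<Sum>C = (\<chi> u v. 1) \<and>
     (\<forall>A\<in>C. (\<exists>u. A $ u $ u \<noteq> 0) \<longrightarrow> diagonal_matrix A) \<and>
     (\<forall>A\<in>C. transpose A \<in> C) \<and>
     (\<forall>A\<in>C. \<forall>B\<in>C. A ** B \<in> span C)"

definition homogeneous :: "(real^'v::finite^'v) set \<Rightarrow> bool" where
  "homogeneous C \<longleftrightarrow> mat 1 \<in> C"

definition belongs_to :: "'v::finite set set \<Rightarrow> (real^'v^'v) set \<Rightarrow> bool" where
  "belongs_to E C \<longleftrightarrow> (\<exists>D\<subseteq>C. adjacency_matrix E = \<Sum>D)"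

text \<open>
  On matrices, the library's \<open>*\<close> and \<open>^\<close> are the entrywise product and power. So powers
  for the matrix product \<open>**\<close> are introduced here, while \<open>*\<close> below is the Schur product.
\<close>

definition matrix_power :: "real^'v::finite^'v \<Rightarrow> nat \<Rightarrow> real^'v^'v" where
  "matrix_power A k = (((**) A) ^^ k) (mat 1)"

definition one_walk_regular :: "'v::finite set set \<Rightarrow> bool" where
  "one_walk_regular E \<longleftrightarrow>
     (let A = adjacency_matrix E in
      \<forall>k>0. \<exists>a b :: real. matrix_power A k * mat 1 = a *\<^sub>R mat 1 \<and> matrix_power A k * A = b *\<^sub>R A)"

end

theory Submission
  imports Defs
begin

text \<open>
  The proof finds a matrix \<open>N\<close> that imitates the rank-one matrix \<open>t t\<^sup>T\<close> of the characteristic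
  vector \<open>t\<close> of the coclique \<open>T\<close>, but that is as regular as the graph. Write \<open>n\<close> for the number
  of vertices, \<open>A\<close> for the adjacency matrix and \<open>J\<close> for the all-ones matrix.
  Both kinds of graph come with an algebra \<open>V\<close> of matrices (the span of the configuration, or of \<open>J\<close> and the powers of \<open>A\<close>) that contains
  \<open>I\<close> and \<open>J\<close>, is closed under transposition and under Schur multiplication by \<open>A\<close>, and has only
  matrices with constant diagonal. Let \<open>N\<close> be the orthogonal projection of \<open>t t\<^sup>T\<close> onto \<open>V\<close>.
  Testing \<open>N\<close> against suitable elements of \<open>V\<close> shows that its diagonal entries are all \<open>|T|/n\<close>,
  that its row sums are all \<open>|T|\<^sup>2/n\<close>, and that it vanishes on the edges, because \<open>t t\<^sup>T\<close> does.
  Moreover \<open>N\<close> is positive semidefinite, since projections onto matrix algebras closed under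
  transposition preserve positivity (\<open>psd_from_trace_form\<close>).

  For the characteristic vector \<open>s\<close> of the clique \<open>S\<close>, only the diagonal of \<open>N\<close> contributes
  to \<open>s\<^sup>T N s\<close>, because distinct vertices of \<open>S\<close> are joined by an edge. This number
  is therefore \<open>|S| |T|/n\<close>. The Cauchy-Schwarz inequality of \<open>N\<close> for \<open>s\<close> and
  the all-ones vector then reads \<open>(|S| |T|\<^sup>2/n)\<^sup>2 \<le> (|S| |T|/n) |T|\<^sup>2\<close>, which for nonempty
  \<open>S\<close> and \<open>T\<close> simplifies to \<open>|S| |T| \<le> n\<close>.
\<close>

section \<open>Positive semidefinite matrices\<close>

definition psd :: "real^'v::finite^'v \<Rightarrow> bool" where
  "psd M \<longleftrightarrow> transpose M = M \<and> (\<forall>x. 0 \<le> x \<bullet> (M *v x))"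

lemma inner_mult_vec_transpose:
  fixes M :: "real^'v::finite^'w::finite"
  shows "x \<bullet> (M *v y) = (transpose M *v x) \<bullet> y"
  by (simp add: dot_lmul_matrix)

lemma symmetric_form_commute:
  fixes M :: "real^'v::finite^'v"
  assumes "transpose M = M"
  shows "x \<bullet> (M *v y) = y \<bullet> (M *v x)"
  by (metis assms inner_commute inner_mult_vec_transpose)

lemma symmetric_form_diff:
  fixes M :: "real^'v::finite^'v"
  assumes "transpose M = M"
  shows "(a *\<^sub>R x - b *\<^sub>R y) \<bullet> (M *v (a *\<^sub>R x - b *\<^sub>R y))
       = a\<^sup>2 * (x \<bullet> (M *v x)) - 2 * a * b * (x \<bullet> (M *v y)) + b\<^sup>2 * (y \<bullet> (M *v y))"
  using symmetric_form_commute[OF assms, of y x]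
  by (simp add: matrix_vector_mult_diff_distrib matrix_vector_mult_scaleR
      inner_diff_left inner_diff_right power2_eq_square algebra_simps)

lemma psd_Cauchy_Schwarz:
  assumes "psd M"
  shows "(x \<bullet> (M *v y))\<^sup>2 \<le> (x \<bullet> (M *v x)) * (y \<bullet> (M *v y))"
proof -
  define a b c where "a = x \<bullet> (M *v x)" and "b = x \<bullet> (M *v y)" and "c = y \<bullet> (M *v y)"
  have form: "0 \<le> p\<^sup>2 * a - 2 * p * q * b + q\<^sup>2 * c" for p q
    using assms symmetric_form_diff[of M p x q y] unfolding psd_def a_def b_def c_def by metis
  have "a \<ge> 0" "c \<ge> 0"
    using assms by (auto simp: psd_def a_def c_def)
  \<comment> \<open>The minimizing combinations show that \<open>a (a c - b\<^sup>2)\<close> and \<open>c (a c - b\<^sup>2)\<close> are nonnegative,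
      which settles the claim unless \<open>a = c = 0\<close>.\<close>
  have "0 \<le> c * (a * c - b\<^sup>2)"
    using form[of c b] by (simp add: power2_eq_square algebra_simps)
  moreover have "0 \<le> a * (a * c - b\<^sup>2)"
    using form[of b a] by (simp add: power2_eq_square algebra_simps)
  moreover have "b\<^sup>2 \<le> a * c" if "a = 0" "c = 0"
    using form[of 1 b] that by (simp add: power2_eq_square)
  ultimately have "b\<^sup>2 \<le> a * c"
    using \<open>a \<ge> 0\<close> \<open>c \<ge> 0\<close> by (auto simp: zero_le_mult_iff)
  then show ?thesis
    by (simp add: a_def b_def c_def)
qed

text \<open>
  A minimizer \<open>v\<close> of the Rayleigh quotient, with minimum \<open>\<lambda>\<close>, is an eigenvector: the form of
  \<open>M - \<lambda> I\<close> is nonnegative and vanishes at \<open>v\<close>, so by Cauchy-Schwarz \<open>v\<close> lies in its radical.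
\<close>

lemma symmetric_least_eigenvector:
  fixes M :: "real^'v::finite^'v"
  assumes sym: "transpose M = M"
  obtains l v where "v \<noteq> 0" "M *v v = l *\<^sub>R v" "\<And>x. l * (x \<bullet> x) \<le> x \<bullet> (M *v x)"
proof -
  let ?S = "sphere 0 1 :: (real^'v) set"
  have "compact ?S" "?S \<noteq> {}"
    by auto
  moreover have "continuous_on ?S (\<lambda>x. x \<bullet> (M *v x))"
    by (intro continuous_intros linear_continuous_on_compose[OF continuous_on_id]) auto
  ultimately obtain v where v: "v \<in> ?S" "\<And>x. x \<in> ?S \<Longrightarrow> v \<bullet> (M *v v) \<le> x \<bullet> (M *v x)"
    using continuous_attains_inf by (metis (no_types, lifting))
  define l where "l = v \<bullet> (M *v v)"
  have least: "l * (x \<bullet> x) \<le> x \<bullet> (M *v x)" for x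
  proof (cases "x = 0")
    case False
    define y where "y = x /\<^sub>R norm x"
    have x: "x = norm x *\<^sub>R y" and "y \<in> ?S"
      using False by (auto simp: y_def)
    have "l * (norm x)\<^sup>2 \<le> (norm x)\<^sup>2 * (y \<bullet> (M *v y))"
      using mult_left_mono[OF v(2)[OF \<open>y \<in> ?S\<close>], of "(norm x)\<^sup>2"] by (simp add: l_def mult.commute)
    also have "\<dots> = x \<bullet> (M *v x)"
      using arg_cong[OF x, of "\<lambda>z. z \<bullet> (M *v z)"]
      by (simp add: matrix_vector_mult_scaleR power2_eq_square)
    finally show ?thesis
      by (simp add: power2_norm_eq_inner)
  qed auto
  define P where "P = M - l *\<^sub>R mat 1"
  have P: "P *v x = M *v x - l *\<^sub>R x" for x
    by (simp add: P_def matrix_vector_mult_diff_rdistrib flip: scaleR_matrix_vector_assoc)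
  have "psd P"
    unfolding psd_def
  proof (intro conjI allI)
    show "transpose P = P"
      using sym by (simp add: P_def transpose_def vec_eq_iff mat_def)
    show "0 \<le> x \<bullet> (P *v x)" for x
      using least[of x] by (simp add: P inner_diff_right)
  qed
  moreover have "v \<bullet> (P *v v) = 0"
    using v(1) by (simp add: P inner_diff_right l_def dot_square_norm)
  ultimately have "((P *v v) \<bullet> (P *v v))\<^sup>2 \<le> 0"
    using psd_Cauchy_Schwarz[of P "P *v v" v] by simp
  then have "M *v v = l *\<^sub>R v"
    by (simp add: P)
  moreover have "v \<noteq> 0"
    using v(1) by auto
  ultimately show ?thesis
    using that least by blast
qed

section \<open>The trace inner product on matrices\<close>

lemma linear_mult_left: "linear (\<lambda>X :: real^'v::finite^'v. M ** X)"
  by (intro linearI) (simp_all add: matrix_add_ldistrib matrix_scalar_ac scalar_matrix_assoc)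

lemma linear_mult_right: "linear (\<lambda>X :: real^'v::finite^'v. X ** M)"
  by (intro linearI)
    (simp_all add: matrix_matrix_mult_def vec_eq_iff sum.distrib distrib_right sum_distrib_left mult.assoc)

lemma linear_transpose: "linear (transpose :: real^'v::finite^'v \<Rightarrow> real^'v^'v)"
  by (intro linearI) (simp_all add: transpose_def vec_eq_iff)

lemma linear_schur: "linear (\<lambda>X :: real^'v::finite^'v. X * M)"
  by (intro linearI) (simp_all add: vec_eq_iff distrib_right)

lemma linear_mult_vec: "linear (\<lambda>X :: real^'v::finite^'v. X *v x)"
  by (intro linearI) (simp_all add: matrix_vector_mult_add_rdistrib scaleR_matrix_vector_assoc)

lemma inner_matrix: "X \<bullet> Y = (\<Sum>u\<in>UNIV. \<Sum>v\<in>UNIV. X $ u $ v * Y $ u $ v)"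
  for X Y :: "real^'v::finite^'v"
  by (simp add: inner_vec_def)

lemma diagonal_schur_one: "X $ u $ u = (X * mat 1) $ u $ u"
  for X :: "real^'v::finite^'v"
  by (simp add: mat_def)

lemma inner_transpose: "transpose X \<bullet> transpose Y = X \<bullet> Y"
  for X Y :: "real^'v::finite^'v"
  unfolding inner_matrix by (subst sum.swap) (simp add: transpose_def)

lemma inner_mult_left: "(M ** X) \<bullet> Y = X \<bullet> (transpose M ** Y)"
  for M X Y :: "real^'v::finite^'v"
proof -
  have "(M ** X) \<bullet> Y = (\<Sum>u\<in>UNIV. \<Sum>v\<in>UNIV. \<Sum>w\<in>UNIV. M $ u $ w * X $ w $ v * Y $ u $ v)"
    by (simp add: inner_matrix matrix_matrix_mult_def sum_distrib_right)
  also have "\<dots> = (\<Sum>u\<in>UNIV. \<Sum>w\<in>UNIV. \<Sum>v\<in>UNIV. M $ u $ w * X $ w $ v * Y $ u $ v)"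
    by (intro sum.cong sum.swap refl)
  also have "\<dots> = (\<Sum>w\<in>UNIV. \<Sum>u\<in>UNIV. \<Sum>v\<in>UNIV. M $ u $ w * X $ w $ v * Y $ u $ v)"
    by (rule sum.swap)
  also have "\<dots> = (\<Sum>w\<in>UNIV. \<Sum>v\<in>UNIV. \<Sum>u\<in>UNIV. M $ u $ w * X $ w $ v * Y $ u $ v)"
    by (intro sum.cong sum.swap refl)
  also have "\<dots> = X \<bullet> (transpose M ** Y)"
    by (simp add: inner_matrix matrix_matrix_mult_def transpose_def sum_distrib_left mult_ac)
  finally show ?thesis .
qed

lemma inner_mult_right: "(M ** X) \<bullet> Y = M \<bullet> (Y ** transpose X)"
  for M X Y :: "real^'v::finite^'v"
proof -
  have "(M ** X) \<bullet> Y = (transpose X ** transpose M) \<bullet> transpose Y"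
    by (metis inner_transpose matrix_transpose_mul)
  also have "\<dots> = transpose M \<bullet> transpose (Y ** transpose X)"
    by (simp add: inner_mult_left matrix_transpose_mul)
  finally show ?thesis
    by (simp add: inner_transpose)
qed

lemma inner_schur: "(X * M) \<bullet> Y = X \<bullet> (Y * M)"
  for M X Y :: "real^'v::finite^'v"
  by (simp add: inner_matrix mult_ac)

lemma orthogonal_projection_matrix:
  fixes V :: "(real^'v::finite^'v) set"
  assumes "subspace V"
  obtains P where "P \<in> V" "\<And>X. X \<in> V \<Longrightarrow> P \<bullet> X = M \<bullet> X"
proof -
  obtain P Z where "P \<in> span V" "\<And>X. X \<in> span V \<Longrightarrow> orthogonal Z X" "M = P + Z"
    using orthogonal_subspace_decomp_exists by blast
  then show ?thesis
    using that assms by (auto simp: inner_add_left orthogonal_def span_eq_iff[THEN iffD2])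
qed

text \<open>
  Take an eigenvector \<open>v\<close> of \<open>M\<close> for the least eigenvalue \<open>\<lambda>\<close>, and let \<open>K\<close> consist of
  the \<open>X \<in> V\<close> with \<open>X v = 0\<close>. The component \<open>e\<close> of \<open>I\<close> in \<open>V\<close> orthogonal to \<open>K\<close> plays the part
  of \<open>v\<close> inside \<open>V\<close>: it satisfies \<open>e v = v\<close>, and \<open>M e - \<lambda> e\<close> is in \<open>K\<close> as well as
  orthogonal to \<open>K\<close>, so that \<open>M e = \<lambda> e\<close>. Since the inner product of \<open>M e\<close>
  with \<open>e\<close> is nonnegative by hypothesis, \<open>\<lambda> \<ge> 0\<close>.
\<close>

lemma psd_from_trace_form:
  fixes V :: "(real^'v::finite^'v) set"
  assumes V: "subspace V" "mat 1 \<in> V"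
    and sym: "transpose M = M"
    and closed: "\<And>X. X \<in> V \<Longrightarrow> M ** X \<in> V"
    and nonneg: "\<And>X. X \<in> V \<Longrightarrow> 0 \<le> (M ** X) \<bullet> X"
  shows "psd M"
proof -
  obtain l v where v: "v \<noteq> 0" "M *v v = l *\<^sub>R v" "\<And>x. l * (x \<bullet> x) \<le> x \<bullet> (M *v x)"
    using symmetric_least_eigenvector[OF sym] by metis
  define K where "K = V \<inter> {X. X *v v = 0}"
  have "subspace K"
    unfolding K_def
    by (intro subspace_inter V linear_subspace_kernel linear_mult_vec)
  then obtain k where k: "k \<in> K" "\<And>X. X \<in> K \<Longrightarrow> k \<bullet> X = mat 1 \<bullet> X"
    using orthogonal_projection_matrix by blast
  define e where "e = mat 1 - k"
  have "e \<in> V" and ev: "e *v v = v"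
    using V k(1) by (auto simp: e_def K_def subspace_diff matrix_vector_mult_diff_rdistrib)
  have e_orth: "e \<bullet> X = 0" if "X \<in> K" for X
    using k(2)[OF that] by (simp add: e_def inner_diff_left)
  define R where "R = M ** e - l *\<^sub>R e"
  have "R *v v = M *v (e *v v) - l *\<^sub>R (e *v v)"
    by (simp add: R_def matrix_vector_mult_diff_rdistrib matrix_vector_mul_assoc
        flip: scaleR_matrix_vector_assoc)
  then have "R \<in> K"
    using \<open>e \<in> V\<close> V closed by (simp add: K_def R_def ev v(2) subspace_diff subspace_scale)
  moreover have "M ** X \<in> K" if "X \<in> K" for X
    using that closed by (auto simp: K_def simp flip: matrix_vector_mul_assoc)
  ultimately have "R \<bullet> R = 0"
    using e_orth by (subst (1) R_def) (simp add: inner_diff_left inner_mult_left sym)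
  then have "M ** e = l *\<^sub>R e"
    by (simp add: R_def)
  then have "0 \<le> l * (e \<bullet> e)"
    using nonneg[OF \<open>e \<in> V\<close>] by simp
  moreover have "0 < e \<bullet> e"
    using ev v(1) by auto
  ultimately have "0 \<le> l"
    by (simp add: zero_le_mult_iff)
  then show ?thesis
    using sym v(3) unfolding psd_def by (meson inner_ge_zero mult_nonneg_nonneg order_trans)
qed

section \<open>Characteristic vectors\<close>

definition char_vec :: "'v::finite set \<Rightarrow> real^'v" where
  "char_vec T = (\<chi> u. indicator T u)"

definition outer :: "real^'v::finite \<Rightarrow> real^'v^'v" where
  "outer x = (\<chi> u v. x $ u * x $ v)"

lemma transpose_outer: "transpose (outer x) = outer x"
  by (simp add: outer_def transpose_def vec_eq_iff mult.commute)

lemma inner_outer: "outer x \<bullet> M = x \<bullet> (M *v x)"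
  by (simp add: inner_matrix outer_def inner_vec_def matrix_vector_mult_def sum_distrib_left mult_ac)

lemma sum_indicator_UNIV: "(\<Sum>u\<in>UNIV. indicator S u) = real (card S)"
  for S :: "'v::finite set"
  by (simp add: indicator_def sum.If_cases)

lemma char_vec_inner: "char_vec S \<bullet> char_vec T = card (S \<inter> T)"
proof -
  have "char_vec S \<bullet> char_vec T = (\<Sum>u\<in>UNIV. indicator (S \<inter> T) u)"
    by (simp add: char_vec_def inner_vec_def indicator_inter_arith)
  then show ?thesis
    by (simp add: sum_indicator_UNIV)
qed

lemma all_ones_mult_vec: "(\<chi> u v. 1) *v x = (x \<bullet> char_vec UNIV) *\<^sub>R char_vec UNIV"
  by (simp add: vec_eq_iff matrix_vector_mult_def char_vec_def inner_vec_def)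

lemma mult_vec_all_ones: "(M *v char_vec UNIV) $ u = (\<Sum>v\<in>UNIV. M $ u $ v)"
  by (simp add: matrix_vector_mult_def char_vec_def)

lemma mult_all_ones: "(M ** (\<chi> u v. 1)) $ u $ v = (M *v char_vec UNIV) $ u"
  by (simp add: mult_vec_all_ones matrix_matrix_mult_def)

section \<open>The clique-coclique bound in a matrix algebra\<close>

text \<open>
  These are the properties that the span of a homogeneous coherent configuration shares with
  the algebra generated by \<open>J\<close> and the adjacency matrix of a \<open>1\<close>-walk regular graph.
\<close>

locale edge_regular_algebra =
  fixes V :: "(real^'v::finite^'v) set" and A :: "real^'v^'v"
  assumes subspace: "subspace V"
    and one: "mat 1 \<in> V"
    and all_ones: "(\<chi> u v. 1) \<in> V"
    and transpose: "X \<in> V \<Longrightarrow> transpose X \<in> V"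
    and mult: "X \<in> V \<Longrightarrow> Y \<in> V \<Longrightarrow> X ** Y \<in> V"
    and constant_diagonal: "X \<in> V \<Longrightarrow> \<exists>c. \<forall>u. X $ u $ u = c"
    and schur: "X \<in> V \<Longrightarrow> X * A \<in> V"
begin

text \<open>The row sums of \<open>X\<close> are the diagonal entries of \<open>X J\<close>.\<close>

lemma constant_row_sums:
  assumes "X \<in> V"
  obtains r where "X *v char_vec UNIV = r *\<^sub>R char_vec UNIV"
proof -
  obtain r where "\<forall>u. (X ** (\<chi> u v. 1)) $ u $ u = r"
    using constant_diagonal[OF mult[OF assms all_ones]] by blast
  then have "X *v char_vec UNIV = r *\<^sub>R char_vec UNIV"
    by (simp add: mult_all_ones vec_eq_iff) (simp add: char_vec_def)
  then show ?thesis
    using that by blast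
qed

text \<open>
  With \<open>t\<close> for the characteristic vector of \<open>T\<close>, all properties of the projection \<open>N\<close> of \<open>t t\<^sup>T\<close>
  come from testing it: against \<open>I\<close> and \<open>J\<close> for the diagonal and the row sums, against
  \<open>N \<circ> A\<close> for the entries on edges, and against the matrices \<open>X X\<^sup>T\<close> for positivity.
\<close>

lemma coclique_matrix:
  assumes coclique: "\<And>u v. u \<in> T \<Longrightarrow> v \<in> T \<Longrightarrow> A $ u $ v = 0"
  obtains N where "psd N" "N * A = 0" "\<And>u. N $ u $ u = card T / CARD('v)"
    "N *v char_vec UNIV = ((real (card T))\<^sup>2 / CARD('v)) *\<^sub>R char_vec UNIV"
proof -
  let ?t = "char_vec T"
  obtain N where N: "N \<in> V" and proj: "\<And>X. X \<in> V \<Longrightarrow> N \<bullet> X = outer ?t \<bullet> X"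
    using orthogonal_projection_matrix[OF subspace] by blast
  have sym: "transpose N = N"
  proof -
    let ?D = "transpose N - N"
    have "transpose N \<bullet> X = N \<bullet> X" if "X \<in> V" for X
    proof -
      have "transpose N \<bullet> X = N \<bullet> transpose X"
        using inner_transpose[of N "transpose X"] by simp
      also have "\<dots> = outer ?t \<bullet> X"
        using proj[OF transpose[OF that]] inner_transpose[of "outer ?t" X]
        by (simp add: transpose_outer)
      finally show ?thesis
        using proj[OF that] by simp
    qed
    then have "?D \<bullet> ?D = 0"
      using N by (simp add: inner_diff_left subspace transpose subspace_diff)
    then show ?thesis
      by simp
  qed
  have "psd N"
  proof (rule psd_from_trace_form[OF subspace one sym])
    fix X assume X: "X \<in> V"
    then show "N ** X \<in> V"
      using N mult by blast
    have "(N ** X) \<bullet> X = N \<bullet> (X ** transpose X)"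
      by (rule inner_mult_right)
    also have "\<dots> = ?t \<bullet> (X *v (transpose X *v ?t))"
      using X by (simp only: proj mult transpose inner_outer matrix_vector_mul_assoc)
    also have "\<dots> = (transpose X *v ?t) \<bullet> (transpose X *v ?t)"
      by (rule inner_mult_vec_transpose)
    finally show "0 \<le> (N ** X) \<bullet> X"
      by simp
  qed
  moreover have "N * A = 0"
  proof -
    have "(N * A) \<bullet> (N * A) = N \<bullet> (N * A * A)"
      by (rule inner_schur)
    also have "\<dots> = outer ?t \<bullet> (N * A * A)"
      by (intro proj schur N)
    also have "\<dots> = 0"
      using coclique
      by (auto simp: inner_matrix outer_def char_vec_def indicator_def intro!: sum.neutral)
    finally show ?thesis
      by simp
  qed
  moreover have "N $ u $ u = card T / CARD('v)" for u
  proof -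
    obtain c where c: "\<And>u. N $ u $ u = c"
      using constant_diagonal[OF N] by blast
    have "N \<bullet> mat 1 = c * CARD('v)"
      by (simp add: inner_matrix mat_def if_distrib c cong: if_cong)
    moreover have "N \<bullet> mat 1 = card T"
      by (simp add: proj one inner_outer char_vec_inner)
    ultimately show ?thesis
      by (simp add: c field_simps)
  qed
  moreover have "N *v char_vec UNIV = ((real (card T))\<^sup>2 / CARD('v)) *\<^sub>R char_vec UNIV"
  proof -
    obtain r where r: "N *v char_vec UNIV = r *\<^sub>R char_vec UNIV"
      using constant_row_sums[OF N] by blast
    have "N \<bullet> (\<chi> u v. 1) = (\<Sum>u\<in>UNIV. (N *v char_vec UNIV) $ u)"
      by (simp add: inner_matrix mult_vec_all_ones)
    also have "\<dots> = r * CARD('v)"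
      by (simp add: r) (simp add: char_vec_def)
    finally have "r * CARD('v) = (real (card T))\<^sup>2"
      by (simp add: proj all_ones inner_outer all_ones_mult_vec char_vec_inner power2_eq_square)
    then show ?thesis
      by (simp add: r field_simps)
  qed
  ultimately show ?thesis
    by (rule that)
qed

lemma clique_coclique_bound:
  assumes clique: "\<And>u v. u \<in> S \<Longrightarrow> v \<in> S \<Longrightarrow> u \<noteq> v \<Longrightarrow> A $ u $ v \<noteq> 0"
    and coclique: "\<And>u v. u \<in> T \<Longrightarrow> v \<in> T \<Longrightarrow> A $ u $ v = 0"
  shows "card S * card T \<le> CARD('v)"
proof (cases "card S * card T = 0")
  case False
  define n s t :: real where "n = CARD('v)" and "s = card S" and "t = card T"
  have pos: "n > 0" "s > 0" "t > 0"
    using False by (auto simp: n_def s_def t_def)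
  let ?s = "char_vec S" and ?j = "char_vec UNIV"
  obtain N where N: "psd N" "N * A = 0" "\<And>u. N $ u $ u = t / n" "N *v ?j = (t\<^sup>2 / n) *\<^sub>R ?j"
    using coclique_matrix[of T, folded n_def t_def] coclique by blast
  have edge: "N $ u $ v * A $ u $ v = 0" for u v
    using arg_cong[OF N(2), of "\<lambda>X. X $ u $ v"] by simp
  have "?s \<bullet> (N *v ?s) = (\<Sum>u\<in>UNIV. \<Sum>v\<in>UNIV. indicator S u * indicator S v * N $ u $ v)"
    by (simp add: inner_matrix outer_def char_vec_def flip: inner_outer)
  also have "\<dots> = (\<Sum>u\<in>UNIV. \<Sum>v\<in>UNIV. if u = v then indicator S u * (t / n) else 0)"
    using clique edge N(3) by (intro sum.cong refl) (auto simp: indicator_def)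
  also have "\<dots> = (\<Sum>u\<in>UNIV. indicator S u * (t / n))"
    by simp
  also have "\<dots> = s * t / n"
    by (simp add: s_def sum_indicator_UNIV flip: sum_distrib_right sum_divide_distrib)
  finally have "(s * t\<^sup>2 / n)\<^sup>2 \<le> s * t / n * t\<^sup>2"
    using psd_Cauchy_Schwarz[OF N(1), of ?s ?j] pos
    by (simp add: N(4) char_vec_inner s_def n_def mult_ac)
  moreover have "(s * t\<^sup>2 / n)\<^sup>2 = (s * t / n * t\<^sup>2) * (s * t / n)"
    by (simp add: power2_eq_square)
  ultimately have "(s * t / n * t\<^sup>2) * (s * t / n) \<le> (s * t / n * t\<^sup>2) * 1"
    by linarith
  moreover have "0 < s * t / n * t\<^sup>2"
    using pos by simp
  ultimately have "s * t / n \<le> 1"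
    by (rule mult_left_le_imp_le)
  then have "s * t \<le> n"
    using pos by simp
  then have "real (card S * card T) \<le> real CARD('v)"
    by (simp add: s_def t_def n_def)
  then show ?thesis
    by (simp only: of_nat_le_iff)
qed auto

end

section \<open>Homogeneous coherent configurations\<close>

lemma linear_image_span_subset:
  assumes "linear f" "subspace V" "\<And>x. x \<in> G \<Longrightarrow> f x \<in> V" "x \<in> span G"
  shows "f x \<in> V"
proof -
  have "f ` span G \<subseteq> V"
    using assms by (simp add: span_minimal image_subsetI flip: linear_span_image)
  then show ?thesis
    using assms by blast
qed

text \<open>Bilinearity reduces closure under products to the generators, one factor at a time.\<close>

lemma mult_closed_span:
  fixes G :: "(real^'v::finite^'v) set"
  assumes "\<And>X Y. X \<in> G \<Longrightarrow> Y \<in> G \<Longrightarrow> X ** Y \<in> span G" "X \<in> span G" "Y \<in> span G"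
  shows "X ** Y \<in> span G"
proof -
  have "X ** Y \<in> span G" if "X \<in> G" for X
    using linear_image_span_subset[OF linear_mult_left subspace_span _ assms(3)] assms(1) that
    by blast
  then show ?thesis
    using linear_image_span_subset[OF linear_mult_right subspace_span _ assms(2)] by blast
qed

lemma constant_diagonal_span:
  fixes G :: "(real^'v::finite^'v) set"
  assumes "\<And>X. X \<in> G \<Longrightarrow> \<exists>c. \<forall>u. X $ u $ u = c" "X \<in> span G"
  shows "\<exists>c. \<forall>u. X $ u $ u = c"
  using assms(2)
proof (induction rule: span_induct_alt)
  case base
  then show ?case by auto
next
  case (step c X Y)
  then show ?case using assms(1)[of X] by auto
qed

text \<open>The classes are \<open>01\<close> matrices with sum \<open>J\<close>, so their supports are pairwise disjoint.\<close>

lemma schur_coherent_configuration: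
  assumes "coherent_configuration C" "X \<in> C" "Y \<in> C"
  shows "X * Y = (if X = Y then X else 0)"
proof -
  have fin: "finite C" and entries: "\<And>A u v. A \<in> C \<Longrightarrow> A $ u $ v \<in> {0, 1}"
    and "\<Sum>C = (\<chi> u v. 1)"
    using assms by (auto simp: coherent_configuration_def)
  then have total: "(\<Sum>A\<in>C. A $ u $ v) = 1" for u v
    by (simp flip: sum_component)
  have "X $ u $ v * Y $ u $ v = 0" if "X \<noteq> Y" for u v
  proof -
    have "X $ u $ v + Y $ u $ v = (\<Sum>A\<in>{X, Y}. A $ u $ v)"
      using that by simp
    also have "\<dots> \<le> (\<Sum>A\<in>C. A $ u $ v)"
      using assms fin entries by (intro sum_mono2) (simp_all, metis DiffD1 insertE order_refl singletonD zero_le_one)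
    finally show ?thesis
      using entries[OF assms(2), of u v] entries[OF assms(3), of u v] total[of u v] by auto
  qed
  moreover have "X $ u $ v * X $ u $ v = X $ u $ v" for u v
    using entries[OF assms(2), of u v] by auto
  ultimately have "(X * Y) $ u $ v = (if X = Y then X else 0) $ u $ v" for u v
    by auto
  then show ?thesis
    by (intro vec_eq_iff[THEN iffD2] allI)
qed

lemma coherent_configuration_algebra:
  fixes E :: "'v::finite set set"
  assumes C: "coherent_configuration C" and hom: "homogeneous C" and E: "belongs_to E C"
  shows "edge_regular_algebra (span C) (adjacency_matrix E)"
proof
  have one: "mat 1 \<in> C"
    using hom by (simp add: homogeneous_def)
  then show "mat 1 \<in> span C"
    by (rule span_base)
  have "\<Sum>C \<in> span C"
    by (intro span_sum span_base)
  then show "(\<chi> u v. 1) \<in> span C"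
    using C by (simp add: coherent_configuration_def)
  show "transpose X \<in> span C" if "X \<in> span C" for X
    using linear_image_span_subset[OF linear_transpose subspace_span _ that] C
    by (auto simp: coherent_configuration_def span_base)
  show "X ** Y \<in> span C" if "X \<in> span C" "Y \<in> span C" for X Y
    using mult_closed_span[OF _ that] C by (auto simp: coherent_configuration_def)
  show "\<exists>c. \<forall>u. X $ u $ u = c" if "X \<in> span C" for X
  proof (rule constant_diagonal_span[OF _ that])
    fix X assume "X \<in> C"
    \<comment> \<open>\<open>I\<close> is a class, so the other classes vanish on the diagonal.\<close>
    then have "X * mat 1 = (if X = mat 1 then X else 0)"
      using schur_coherent_configuration[OF C _ one] by blast
    then have "X $ u $ u = (if X = mat 1 then 1 else 0)" for u
      by (subst diagonal_schur_one) (simp add: mat_def)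
    then show "\<exists>c. \<forall>u. X $ u $ u = c"
      by blast
  qed
  obtain D where D: "D \<subseteq> C" "adjacency_matrix E = \<Sum>D"
    using E by (auto simp: belongs_to_def)
  show "X * adjacency_matrix E \<in> span C" if "X \<in> span C" for X
  proof (rule linear_image_span_subset[OF linear_schur subspace_span _ that])
    fix X assume X: "X \<in> C"
    have "X * Y \<in> span C" if "Y \<in> D" for Y
      using that X D schur_coherent_configuration[OF C X, of Y] by (auto simp: span_base span_zero)
    then show "X * adjacency_matrix E \<in> span C"
      by (simp add: D(2) sum_distrib_left span_sum)
  qed
qed simp

section \<open>One-walk regular graphs\<close>

lemma matrix_power_0 [simp]: "matrix_power A 0 = mat 1"
  and matrix_power_Suc: "matrix_power A (Suc k) = A ** matrix_power A k"
  by (simp_all add: matrix_power_def)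

lemma matrix_power_add: "matrix_power A (j + k) = matrix_power A j ** matrix_power A k"
  by (induction j) (simp_all add: matrix_power_Suc matrix_mul_assoc)

lemma matrix_power_commute: "matrix_power A k ** A = A ** matrix_power A k"
  using matrix_power_add[of A k 1] matrix_power_add[of A 1 k]
  by (simp add: add.commute matrix_power_Suc)

lemma transpose_matrix_power:
  assumes "transpose A = A"
  shows "transpose (matrix_power A k) = matrix_power A k"
  by (induction k)
    (simp_all add: matrix_power_Suc matrix_transpose_mul assms matrix_power_commute)

lemma transpose_adjacency_matrix: "transpose (adjacency_matrix E) = adjacency_matrix E"
  by (simp add: adjacency_matrix_def transpose_def vec_eq_iff insert_commute)

lemma loopless_adjacency_matrix: "simple_graph E \<Longrightarrow> adjacency_matrix E $ u $ u = 0"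
  using doubleton_in_nsets_2[of u u UNIV] by (auto simp: simple_graph_def adjacency_matrix_def)

text \<open>The degrees are the diagonal entries of \<open>A\<^sup>2\<close>, so a \<open>1\<close>-walk regular graph is regular.\<close>

lemma one_walk_regular_regular:
  assumes "one_walk_regular E"
  obtains d where "adjacency_matrix E *v char_vec UNIV = d *\<^sub>R char_vec UNIV"
proof -
  let ?A = "adjacency_matrix E"
  obtain d where "matrix_power ?A 2 * mat 1 = d *\<^sub>R mat 1"
    using assms by (fastforce simp: one_walk_regular_def Let_def)
  then have diag: "(?A ** ?A) $ u $ u = d" for u
    by (subst diagonal_schur_one) (simp add: numeral_2_eq_2 matrix_power_Suc, simp add: mat_def)
  have "(?A *v char_vec UNIV) $ u = (?A ** ?A) $ u $ u" for u
    unfolding mult_vec_all_ones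
    by (auto simp: matrix_matrix_mult_def adjacency_matrix_def insert_commute intro!: sum.cong)
  then have "?A *v char_vec UNIV = d *\<^sub>R char_vec UNIV"
    by (simp add: vec_eq_iff diag) (simp add: char_vec_def)
  then show ?thesis
    using that by blast
qed

text \<open>
  For a disconnected graph \<open>J\<close> is not a polynomial in \<open>A\<close>, so it is added as a generator.
  Regularity makes \<open>A\<^sup>k J\<close> and \<open>J A\<^sup>k\<close> multiples of \<open>J\<close>, hence the span stays closed under products.
\<close>

lemma one_walk_regular_algebra:
  fixes E :: "'v::finite set set"
  assumes simple: "simple_graph E" and walk: "one_walk_regular E"
  defines "A \<equiv> adjacency_matrix E"
  shows "edge_regular_algebra (span (insert (\<chi> u v. 1) (range (matrix_power A)))) A"
proof -
  define J :: "real^'v^'v" where "J = (\<chi> u v. 1)"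
  define G where "G = insert J (range (matrix_power A))"
  have J: "J \<in> G" and pow: "matrix_power A k \<in> G" for k
    by (auto simp: G_def)
  have transpose_G: "transpose X = X" if "X \<in> G" for X
    using that transpose_matrix_power[of A]
    by (auto simp: G_def J_def A_def transpose_adjacency_matrix) (simp add: transpose_def)
  obtain d where d: "A *v char_vec UNIV = d *\<^sub>R char_vec UNIV"
    using one_walk_regular_regular[OF walk] unfolding A_def by blast
  have pow_vec: "matrix_power A k *v char_vec UNIV = d ^ k *\<^sub>R char_vec UNIV" for k
    by (induction k)
      (simp_all add: matrix_power_Suc d matrix_vector_mult_scaleR flip: matrix_vector_mul_assoc)
  have eigen: "\<exists>c. X *v char_vec UNIV = c *\<^sub>R char_vec UNIV" if "X \<in> G" for X
    using that pow_vec by (auto simp: G_def J_def all_ones_mult_vec)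
  have mult_J: "\<exists>c. X ** J = c *\<^sub>R J" if X: "X \<in> G" for X
  proof -
    obtain c where c: "X *v char_vec UNIV = c *\<^sub>R char_vec UNIV"
      using eigen[OF X] by blast
    have "X ** J = c *\<^sub>R J"
      unfolding J_def vec_eq_iff mult_all_ones c by (simp add: char_vec_def)
    then show ?thesis
      by blast
  qed
  \<comment> \<open>All generators are symmetric, so this is the transpose of the preceding fact.\<close>
  have J_mult: "\<exists>c. J ** X = c *\<^sub>R J" if X: "X \<in> G" for X
    using mult_J[OF X] transpose_G[OF X] transpose_G[OF J]
    by (metis matrix_transpose_mul transpose_scalar)
  have "edge_regular_algebra (span G) A"
  proof
    show "mat 1 \<in> span G"
      using pow[of 0] by (simp add: span_base)
    show "(\<chi> u v. 1) \<in> span G"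
      using J by (simp add: J_def span_base)
    show "transpose X \<in> span G" if "X \<in> span G" for X
      using linear_image_span_subset[OF linear_transpose subspace_span _ that] transpose_G
      by (auto simp: span_base)
    show "X ** Y \<in> span G" if "X \<in> span G" "Y \<in> span G" for X Y
    proof (rule mult_closed_span[OF _ that])
      fix X Y assume X: "X \<in> G" and Y: "Y \<in> G"
      consider "X = J" | "Y = J" | j k where "X = matrix_power A j" "Y = matrix_power A k"
        using X Y by (auto simp: G_def)
      then show "X ** Y \<in> span G"
        using J_mult[OF Y] mult_J[OF X] J pow
        by cases (auto simp: span_base span_scale simp flip: matrix_power_add)
    qed
    show "\<exists>c. \<forall>u. X $ u $ u = c" if "X \<in> span G" for X
    proof (rule constant_diagonal_span[OF _ that])
      fix X assume "X \<in> G"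
      then consider "X = J" | "X = mat 1" | k where "k > 0" "X = matrix_power A k"
        by (auto simp: G_def) (metis gr0I matrix_power_0)
      then show "\<exists>c. \<forall>u. X $ u $ u = c"
      proof cases
        case 3
        then obtain a where "X * mat 1 = a *\<^sub>R mat 1"
          using walk by (auto simp: one_walk_regular_def Let_def A_def)
        then have "X $ u $ u = a" for u
          by (subst diagonal_schur_one) (simp add: mat_def)
        then show ?thesis
          by blast
      qed (auto simp: J_def mat_def)
    qed
    show "X * A \<in> span G" if "X \<in> span G" for X
    proof (rule linear_image_span_subset[OF linear_schur subspace_span _ that])
      fix X assume "X \<in> G"
      then consider "X = J" | "X = mat 1" | k where "k > 0" "X = matrix_power A k"
        by (auto simp: G_def) (metis gr0I matrix_power_0)
      then have "\<exists>b. X * A = b *\<^sub>R A"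
      proof cases
        case 1
        then show ?thesis
          by (intro exI[of _ 1]) (simp add: J_def vec_eq_iff)
      next
        case 2
        then show ?thesis
          by (intro exI[of _ 0])
            (simp add: vec_eq_iff mat_def A_def loopless_adjacency_matrix[OF simple])
      next
        case 3
        then show ?thesis
          using walk by (auto simp: one_walk_regular_def Let_def A_def)
      qed
      moreover have "A \<in> G"
        using pow[of 1] by (simp add: matrix_power_Suc)
      ultimately show "X * A \<in> span G"
        by (auto simp: span_base span_scale)
    qed
  qed simp
  then show ?thesis
    by (simp add: G_def J_def)
qed

section \<open>Cliques and cocliques\<close>

theorem corollary9:
  fixes E :: "'v::finite set set" and S T :: "'v set"
  assumes "simple_graph E"
    and "(\<exists>C. coherent_configuration C \<and> homogeneous C \<and> belongs_to E C) \<or> one_walk_regular E"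
    and "clique S E"
    and "indep T E"
  shows "card S * card T \<le> CARD('v)"
proof -
  let ?A = "adjacency_matrix E"
  obtain V where "edge_regular_algebra V ?A"
    using assms(1,2) coherent_configuration_algebra one_walk_regular_algebra by metis
  then interpret edge_regular_algebra V ?A .
  show ?thesis
  proof (rule clique_coclique_bound)
    show "?A $ u $ v \<noteq> 0" if "u \<in> S" "v \<in> S" "u \<noteq> v" for u v
      using assms(3) that by (simp add: clique_def adjacency_matrix_def)
    show "?A $ u $ v = 0" if "u \<in> T" "v \<in> T" for u v
      using assms(4) that loopless_adjacency_matrix[OF assms(1), of u]
      by (cases "u = v") (auto simp: indep_def adjacency_matrix_def)
  qed
qed

end
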